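(* Let $(A,\mu,\alpha)$ be a multiplicative non-Hom-associative algebra over $\mathbb{K}$. For $x,y,z\in A$ define the commutator $[x,y]:=\mu(x,y)-\mu(y,x)$ and the Hom-associator $\mathfrak{as}(x,y,z):=\mu(\mu(x,y),\alpha(z))-\mu(\alpha(x),\mu(y,z))$. Then the commutator-Hom-associator algebra $(A,[-,-],\mathfrak{as}(-,-,-),\alpha)$ is a multiplicative Hom-Akivis algebra.
   Context: $\mathbb{K}$ is a field of characteristic $0$; all vector spaces are over $\mathbb{K}$. A multiplicative non-Hom-associative (i.e. not necessarily Hom-associative) algebra is a triple $(A,\mu,\alpha)$ where $A$ is a vector space, $\alpha:A\to A$ is linear, $\mu:A\times A\to A$ is bilinear, and $\alpha(\mu(x,y))=\mu(\alpha(x),\alpha(y))$ for all $x,y\in A$. A Hom-Akivis algebra is a quadruple $(V,[-,-],[-,-,-],\alpha)$ where $V$ is a vector space, $[-,-]:V\times V\to V$ is a skew-symmetric bilinear map, $[-,-,-]:V\times V\times V\to V$ is a trilinear map and $\alpha:V\to V$ is a linear map such that $\sigma[[x,y],\alpha(z)]=\sigma[x,y,z]-\sigma[y,x,z]$ for all $x,y,z\in V$, where $\sigma$ denotes the sum over cyclic permutations of $x,y,z$. It is multiplicative if $\alpha$ is an endomorphism with respect to both $[-,-]$ and $[-,-,-]$, i.e. $\alpha([x,y])=[\alpha(x),\alpha(y)]$ and $\alpha([x,y,z])=[\alpha(x),\alpha(y),\alpha(z)]$. *)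

theory Defs
  imports Complex_Main
begin

text \<open>A vector space is given by its scalar multiplication, as in the locale
  \<^locale>\<open>vector_space\<close>. Linearity over an arbitrary field is
  \<^locale>\<open>Vector_Spaces.linear\<close>; the unqualified name denotes linearity over the reals.\<close>

definition bilinear_map ::
    "('k::field_char_0 \<Rightarrow> 'a::ab_group_add \<Rightarrow> 'a) \<Rightarrow> ('a \<Rightarrow> 'a \<Rightarrow> 'a) \<Rightarrow> bool" where
  "bilinear_map s f \<longleftrightarrow>
     (\<forall>y. Vector_Spaces.linear s s (\<lambda>x. f x y)) \<and>
     (\<forall>x. Vector_Spaces.linear s s (\<lambda>y. f x y))"

definition trilinear_map ::
    "('k::field_char_0 \<Rightarrow> 'a::ab_group_add \<Rightarrow> 'a) \<Rightarrow> ('a \<Rightarrow> 'a \<Rightarrow> 'a \<Rightarrow> 'a) \<Rightarrow> bool" where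
  "trilinear_map s f \<longleftrightarrow>
     (\<forall>y z. Vector_Spaces.linear s s (\<lambda>x. f x y z)) \<and>
     (\<forall>x z. Vector_Spaces.linear s s (\<lambda>y. f x y z)) \<and>
     (\<forall>x y. Vector_Spaces.linear s s (\<lambda>z. f x y z))"

text \<open>The sum over the cyclic permutations of the three variables.\<close>

definition cyclic_sum :: "('a \<Rightarrow> 'a \<Rightarrow> 'a \<Rightarrow> 'a::ab_group_add) \<Rightarrow> 'a \<Rightarrow> 'a \<Rightarrow> 'a \<Rightarrow> 'a" where
  "cyclic_sum f x y z = f x y z + f y z x + f z x y"

text \<open>``Non-Hom-associative'' means ``not necessarily Hom-associative''.\<close>

locale multiplicative_non_hom_associative_algebra = vector_space scale
  for scale :: "'k::field_char_0 \<Rightarrow> 'a::ab_group_add \<Rightarrow> 'a" +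
  fixes mu :: "'a \<Rightarrow> 'a \<Rightarrow> 'a" and alpha :: "'a \<Rightarrow> 'a"
  assumes alpha_linear: "Vector_Spaces.linear scale scale alpha"
    and mu_bilinear: "bilinear_map scale mu"
    and alpha_mu: "alpha (mu x y) = mu (alpha x) (alpha y)"

locale hom_akivis_algebra = vector_space scale
  for scale :: "'k::field_char_0 \<Rightarrow> 'a::ab_group_add \<Rightarrow> 'a" +
  fixes br :: "'a \<Rightarrow> 'a \<Rightarrow> 'a" and tr :: "'a \<Rightarrow> 'a \<Rightarrow> 'a \<Rightarrow> 'a" and alpha :: "'a \<Rightarrow> 'a"
  assumes br_bilinear: "bilinear_map scale br"
    and br_skew: "br x y = - br y x"
    and tr_trilinear: "trilinear_map scale tr"
    and alpha_linear: "Vector_Spaces.linear scale scale alpha"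
    and hom_akivis_identity:
      "cyclic_sum (\<lambda>x y z. br (br x y) (alpha z)) x y z =
       cyclic_sum (\<lambda>x y z. tr x y z) x y z - cyclic_sum (\<lambda>x y z. tr y x z) x y z"

locale multiplicative_hom_akivis_algebra = hom_akivis_algebra +
  assumes alpha_br: "alpha (br x y) = br (alpha x) (alpha y)"
    and alpha_tr: "alpha (tr x y z) = tr (alpha x) (alpha y) (alpha z)"

definition commutator :: "('a \<Rightarrow> 'a \<Rightarrow> 'a::ab_group_add) \<Rightarrow> 'a \<Rightarrow> 'a \<Rightarrow> 'a" where
  "commutator mu x y = mu x y - mu y x"

definition hom_associator ::
    "('a \<Rightarrow> 'a \<Rightarrow> 'a::ab_group_add) \<Rightarrow> ('a \<Rightarrow> 'a) \<Rightarrow> 'a \<Rightarrow> 'a \<Rightarrow> 'a \<Rightarrow> 'a" where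
  "hom_associator mu alpha x y z = mu (mu x y) (alpha z) - mu (alpha x) (mu y z)"

end

theory Submission
  imports Defs
begin

text \<open>The commutator and the Hom-associator are signed sums of composites of \<open>mu\<close>
  and \<open>alpha\<close>, so they inherit multilinearity. An endomorphism of \<open>mu\<close>
  that trivially commutes with itself preserves both. The heart is
  \<open>hom_akivis_identity_commutator\<close>, where both cyclic sums expand to the same signed
  products.\<close>

context multiplicative_non_hom_associative_algebra
begin

text \<open>Turns each linearity claim into equations that rewriting can settle.\<close>

lemma linear_iff_add_scale:
  "Vector_Spaces.linear scale scale f \<longleftrightarrow>
    (\<forall>x y. f (x + y) = f x + f y) \<and> (\<forall>c x. f (scale c x) = scale c (f x))"
  by (simp add: Vector_Spaces.linear_iff vector_space_axioms)

lemma alpha_simps: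
  "alpha (x + y) = alpha x + alpha y"
  "alpha (x - y) = alpha x - alpha y"
  "alpha (scale c x) = scale c (alpha x)"
proof -
  interpret alpha: Vector_Spaces.linear scale scale alpha
    by (rule alpha_linear)
  show "alpha (x + y) = alpha x + alpha y"
    "alpha (x - y) = alpha x - alpha y"
    "alpha (scale c x) = scale c (alpha x)"
    by (fact alpha.add alpha.diff alpha.scale)+
qed

lemma mu_left_simps:
  "mu (x + y) z = mu x z + mu y z"
  "mu (x - y) z = mu x z - mu y z"
  "mu (scale c x) z = scale c (mu x z)"
proof -
  interpret left: Vector_Spaces.linear scale scale "\<lambda>x. mu x z"
    using mu_bilinear by (simp add: bilinear_map_def)
  show "mu (x + y) z = mu x z + mu y z"
    "mu (x - y) z = mu x z - mu y z"
    "mu (scale c x) z = scale c (mu x z)"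
    by (fact left.add left.diff left.scale)+
qed

lemma mu_right_simps:
  "mu z (x + y) = mu z x + mu z y"
  "mu z (x - y) = mu z x - mu z y"
  "mu z (scale c x) = scale c (mu z x)"
proof -
  interpret right: Vector_Spaces.linear scale scale "mu z"
    using mu_bilinear by (simp add: bilinear_map_def)
  show "mu z (x + y) = mu z x + mu z y"
    "mu z (x - y) = mu z x - mu z y"
    "mu z (scale c x) = scale c (mu z x)"
    by (fact right.add right.diff right.scale)+
qed

text \<open>Both new operations are differences, so homogeneity also needs scalars to distribute
  over subtraction.\<close>

lemmas multilinear_simps = alpha_simps mu_left_simps mu_right_simps scale_right_diff_distrib

lemma commutator_bilinear: "bilinear_map scale (commutator mu)"
  by (simp add: bilinear_map_def linear_iff_add_scale commutator_def multilinear_simps)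

lemma hom_associator_trilinear: "trilinear_map scale (hom_associator mu alpha)"
  by (simp add: trilinear_map_def linear_iff_add_scale hom_associator_def multilinear_simps)

text \<open>Products with \<open>alpha\<close> on the right agree term by term. Those with
  \<open>alpha\<close> on the left agree after a cyclic shift of the variables:
  \<open>- mu (alpha x) (mu y z)\<close> shifts to \<open>- mu (alpha z) (mu x y)\<close>, and
  \<open>mu (alpha y) (mu x z)\<close> to \<open>mu (alpha z) (mu y x)\<close>.\<close>

lemma hom_akivis_identity_commutator:
  "cyclic_sum (\<lambda>x y z. commutator mu (commutator mu x y) (alpha z)) x y z =
    cyclic_sum (hom_associator mu alpha) x y z -
    cyclic_sum (\<lambda>x y z. hom_associator mu alpha y x z) x y z"
  by (simp add: cyclic_sum_def commutator_def hom_associator_def mu_left_simps mu_right_simps)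

end

theorem theorem4p2:
  fixes scale :: "'k::field_char_0 \<Rightarrow> 'a::ab_group_add \<Rightarrow> 'a"
    and mu :: "'a \<Rightarrow> 'a \<Rightarrow> 'a" and alpha :: "'a \<Rightarrow> 'a"
  assumes "multiplicative_non_hom_associative_algebra scale mu alpha"
  shows "multiplicative_hom_akivis_algebra scale (commutator mu) (hom_associator mu alpha) alpha"
proof -
  interpret multiplicative_non_hom_associative_algebra scale mu alpha
    by (fact assms)
  show ?thesis
  proof unfold_locales
    show "commutator mu x y = - commutator mu y x" for x y
      by (simp add: commutator_def)
    show "alpha (commutator mu x y) = commutator mu (alpha x) (alpha y)" for x y
      by (simp add: commutator_def alpha_simps alpha_mu)
    show "alpha (hom_associator mu alpha x y z) =
        hom_associator mu alpha (alpha x) (alpha y) (alpha z)" for x y z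
      by (simp add: hom_associator_def alpha_simps alpha_mu)
  \<comment> \<open>Linearity of \<open>alpha\<close> is itself a locale predicate, so
    \<open>unfold_locales\<close> splits it into additivity and homogeneity; hence
    \<open>alpha_simps\<close> here.\<close>
  qed (fact commutator_bilinear hom_associator_trilinear alpha_simps
      hom_akivis_identity_commutator)+
qed

end
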